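(* Consider an ODMTS design $\mathbf z^1$ and assume that the optimal route for trip $r$ under $\mathbf z^1$ is a direct shuttle trip with trip time $t^1$. For any ODMTS design $\mathbf z^2\ge\mathbf z^1$, the time $t^2$ of the optimal route for trip $r$ under $\mathbf z^2$ satisfies $$t^2\le\max\left\{t^1,\ t^1+\frac{1-\theta}{\theta}\,g\left(d_{or^rde^r}-\min_{h,l\in H}\{d_{or^rh}+d_{lde^r}\}\right)\right\}.$$
   Context: $N$ is a finite set of nodes, $H\subseteq N$ the set of hubs. Trip $r$ has distinct origin $or^r$ and destination $de^r$ in $N\setminus H$. For $i,j\in N$, $t_{ij}\ge0$ and $d_{ij}\ge0$ are travel time and distance (possibly asymmetric), each satisfying the triangle inequality. $\theta\in(0,1]$, $g\ge0$ is the shuttle cost per mile, $s\ge0$ the average bus waiting time. Put $\gamma^r_{ij}=(1-\theta)g\,d_{ij}+\theta t_{ij}$ and $\tau^r_{hl}=\theta(t_{hl}+s)$. An ODMTS design is a $\mathbf z\in\{0,1\}^{|H|\times|H|}$ ($z_{hl}=1$ iff the bus leg from $h$ to $l$ is open); $\mathbf z^1\le\mathbf z^2$ means $z^1_{hl}\le z^2_{hl}$ for all $h,l\in H$. Given $\mathbf z$, the optimal route of $r$ is a solution of: lexicographically minimize $\langle b^r,f^r\rangle$ (first $b^r$, then $f^r$) over binary $x^r_{hl}$ ($h,l\in H$) and $y^r_{ij}$ ($(i,j)\in A^r$), with $b^r=\sum\tau^r_{hl}x^r_{hl}+\sum\gamma^r_{ij}y^r_{ij}$, $f^r=\sum(t_{hl}+s)x^r_{hl}+\sum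 t_{ij}y^r_{ij}$, subject to $x^r_{hl}\le z_{hl}$ and unit flow conservation from $or^r$ to $de^r$ over bus legs ($x$) and shuttle legs ($y$). Here $A^r=\{(or^r,h),(h,de^r):h\in H\}\cup\{(or^r,de^r)\}$ (other shuttle arcs are unnecessary by the triangle inequality). A route is either a direct shuttle ride from $or^r$ to $de^r$, or a shuttle from $or^r$ to a hub, bus leg(s) between hubs, and a shuttle from a hub to $de^r$. The (trip) time of the optimal route is the lexicographically optimal value of $f^r$ (unique for given $\mathbf z$). *)

theory Defs
  imports Complex_Main "HOL-Library.FuncSet"
begin

text \<open>
  Costs, times and decision variables are functions on all (pairs of) elements of the type \<open>'n\<close>;
  only their values at the nodes, respectively at the arcs, are ever used.
  Binary variables are \<open>{0, 1}\<close>-valued real functions on arcs.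
\<close>

type_synonym 'n arc_fun = "'n \<times> 'n \<Rightarrow> real"

definition shuttle_arcs :: "'n set \<Rightarrow> 'n \<Rightarrow> 'n \<Rightarrow> ('n \<times> 'n) set" where
  "shuttle_arcs H org dst = (\<lambda>h. (org, h)) ` H \<union> (\<lambda>h. (h, dst)) ` H \<union> {(org, dst)}"

definition is_design :: "'n set \<Rightarrow> 'n arc_fun \<Rightarrow> bool" where
  "is_design H z \<longleftrightarrow> z \<in> H \<times> H \<rightarrow> {0, 1}"

definition design_le :: "'n set \<Rightarrow> 'n arc_fun \<Rightarrow> 'n arc_fun \<Rightarrow> bool" where
  "design_le H z1 z2 \<longleftrightarrow> (\<forall>h\<in>H. \<forall>l\<in>H. z1 (h, l) \<le> z2 (h, l))"

definition shuttle_cost ::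
    "('n \<Rightarrow> 'n \<Rightarrow> real) \<Rightarrow> ('n \<Rightarrow> 'n \<Rightarrow> real) \<Rightarrow> real \<Rightarrow> real \<Rightarrow> 'n \<Rightarrow> 'n \<Rightarrow> real" where
  "shuttle_cost t d \<theta> g i j = (1 - \<theta>) * g * d i j + \<theta> * t i j"

definition bus_cost :: "('n \<Rightarrow> 'n \<Rightarrow> real) \<Rightarrow> real \<Rightarrow> real \<Rightarrow> 'n \<Rightarrow> 'n \<Rightarrow> real" where
  "bus_cost t \<theta> s h l = \<theta> * (t h l + s)"

definition route_cost ::
    "'n set \<Rightarrow> ('n \<Rightarrow> 'n \<Rightarrow> real) \<Rightarrow> ('n \<Rightarrow> 'n \<Rightarrow> real) \<Rightarrow> real \<Rightarrow> real \<Rightarrow> real \<Rightarrow> 'n \<Rightarrow> 'n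
      \<Rightarrow> 'n arc_fun \<Rightarrow> 'n arc_fun \<Rightarrow> real" where
  "route_cost H t d \<theta> g s org dst x y =
     (\<Sum>(h, l)\<in>H \<times> H. bus_cost t \<theta> s h l * x (h, l)) +
     (\<Sum>(i, j)\<in>shuttle_arcs H org dst. shuttle_cost t d \<theta> g i j * y (i, j))"

definition route_time ::
    "'n set \<Rightarrow> ('n \<Rightarrow> 'n \<Rightarrow> real) \<Rightarrow> real \<Rightarrow> 'n \<Rightarrow> 'n \<Rightarrow> 'n arc_fun \<Rightarrow> 'n arc_fun \<Rightarrow> real" where
  "route_time H t s org dst x y =
     (\<Sum>(h, l)\<in>H \<times> H. (t h l + s) * x (h, l)) +
     (\<Sum>(i, j)\<in>shuttle_arcs H org dst. t i j * y (i, j))"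

definition net_outflow :: "('n \<times> 'n) set \<Rightarrow> 'n arc_fun \<Rightarrow> 'n \<Rightarrow> real" where
  "net_outflow A v i = (\<Sum>a\<in>{a \<in> A. fst a = i}. v a) - (\<Sum>a\<in>{a \<in> A. snd a = i}. v a)"

definition feasible_route ::
    "'n set \<Rightarrow> 'n set \<Rightarrow> 'n \<Rightarrow> 'n \<Rightarrow> 'n arc_fun \<Rightarrow> 'n arc_fun \<Rightarrow> 'n arc_fun \<Rightarrow> bool" where
  "feasible_route N H org dst z x y \<longleftrightarrow>
     x \<in> H \<times> H \<rightarrow> {0, 1} \<and>
     y \<in> shuttle_arcs H org dst \<rightarrow> {0, 1} \<and>
     (\<forall>h\<in>H. \<forall>l\<in>H. x (h, l) \<le> z (h, l)) \<and>
     (\<forall>i\<in>N. net_outflow (H \<times> H) x i + net_outflow (shuttle_arcs H org dst) y i =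
        (if i = org then 1 else if i = dst then -1 else 0))"

definition lex_le :: "real \<times> real \<Rightarrow> real \<times> real \<Rightarrow> bool" where
  "lex_le p q \<longleftrightarrow> fst p < fst q \<or> fst p = fst q \<and> snd p \<le> snd q"

definition optimal_route ::
    "'n set \<Rightarrow> 'n set \<Rightarrow> ('n \<Rightarrow> 'n \<Rightarrow> real) \<Rightarrow> ('n \<Rightarrow> 'n \<Rightarrow> real) \<Rightarrow> real \<Rightarrow> real \<Rightarrow> real \<Rightarrow> 'n \<Rightarrow> 'n
      \<Rightarrow> 'n arc_fun \<Rightarrow> 'n arc_fun \<Rightarrow> 'n arc_fun \<Rightarrow> bool" where
  "optimal_route N H t d \<theta> g s org dst z x y \<longleftrightarrow>
     feasible_route N H org dst z x y \<and>
     (\<forall>x' y'. feasible_route N H org dst z x' y' \<longrightarrow>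
        lex_le (route_cost H t d \<theta> g s org dst x y, route_time H t s org dst x y)
               (route_cost H t d \<theta> g s org dst x' y', route_time H t s org dst x' y'))"

text \<open>The optimal value of the time is the same for all optimal routes of a given design.\<close>

lemma optimal_route_time_unique:
  assumes "optimal_route N H t d \<theta> g s org dst z x y"
    and "optimal_route N H t d \<theta> g s org dst z x' y'"
  shows "route_time H t s org dst x y = route_time H t s org dst x' y'"
  using assms unfolding optimal_route_def lex_le_def by fastforce

definition direct_route ::
    "'n set \<Rightarrow> 'n \<Rightarrow> 'n \<Rightarrow> 'n arc_fun \<Rightarrow> 'n arc_fun \<Rightarrow> bool" where
  "direct_route H org dst x y \<longleftrightarrow>
     (\<forall>a\<in>H \<times> H. x a = 0) \<and>
     (\<forall>a\<in>shuttle_arcs H org dst. y a = (if a = (org, dst) then 1 else 0))"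

lemma feasible_direct_route:
  assumes "finite N" "H \<subseteq> N" "org \<in> N - H" "dst \<in> N - H" "org \<noteq> dst" "is_design H z"
    and "direct_route H org dst x y"
  shows "feasible_route N H org dst z x y"
proof -
  let ?A = "shuttle_arcs H org dst"
  have A: "finite ?A" "(org, dst) \<in> ?A"
    using assms finite_subset by (auto simp: shuttle_arcs_def)
  have x: "x a = 0" if "a \<in> H \<times> H" for a
    using assms(7) that by (auto simp: direct_route_def)
  have y: "y a = (if a = (org, dst) then 1 else 0)" if "a \<in> ?A" for a
    using assms(7) that by (auto simp: direct_route_def)
  have outx: "net_outflow (H \<times> H) x i = 0" for i
    unfolding net_outflow_def using x by (simp add: sum.neutral)
  have outy: "(\<Sum>a\<in>{a \<in> ?A. P a}. y a) = (if P (org, dst) then 1 else 0)" for P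
  proof -
    have "(\<Sum>a\<in>{a \<in> ?A. P a}. y a) = (\<Sum>a\<in>{a \<in> ?A. P a}. if a = (org, dst) then 1 else 0)"
      using y by (intro sum.cong) auto
    also have "\<dots> = (if P (org, dst) then 1 else 0)"
      using A by (simp add: sum.delta)
    finally show ?thesis .
  qed
  have "net_outflow ?A y i = (if i = org then 1 else if i = dst then -1 else 0)" for i
    unfolding net_outflow_def outy using assms(5) by auto
  moreover have "x (h, l) \<le> z (h, l)" if "h \<in> H" "l \<in> H" for h l
  proof -
    have "z (h, l) \<in> {0, 1}"
      using assms(6) that unfolding is_design_def by blast
    then show ?thesis using x[of "(h, l)"] that by auto
  qed
  ultimately show ?thesis
    unfolding feasible_route_def using x y outx by (auto simp: Pi_def)
qed

lemma optimal_route_exists: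
  assumes "finite N" "H \<subseteq> N" "org \<in> N - H" "dst \<in> N - H" "org \<noteq> dst" "is_design H z"
  shows "\<exists>x y. optimal_route N H t d \<theta> g s org dst z x y"
proof -
  let ?A = "shuttle_arcs H org dst"
  define V where "V x y = (route_cost H t d \<theta> g s org dst x y, route_time H t s org dst x y)" for x y
  define S where "S = {V x y | x y. feasible_route N H org dst z x y}"
  have finH: "finite H" using assms finite_subset by auto
  then have finA: "finite ?A" by (auto simp: shuttle_arcs_def)
  have "S \<subseteq> (\<lambda>(x, y). V x y) ` ((H \<times> H \<rightarrow>\<^sub>E {0, 1}) \<times> (?A \<rightarrow>\<^sub>E {0, 1}))"
  proof
    fix v assume "v \<in> S"
    then obtain x y where xy: "feasible_route N H org dst z x y" "v = V x y"
      by (auto simp: S_def)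
    have "V x y = V (restrict x (H \<times> H)) (restrict y ?A)"
      unfolding V_def route_cost_def route_time_def
      by (auto intro!: arg_cong2[where f = "(+)"] sum.cong)
    moreover have "restrict x (H \<times> H) \<in> H \<times> H \<rightarrow>\<^sub>E {0, 1}" "restrict y ?A \<in> ?A \<rightarrow>\<^sub>E {0, 1}"
      using xy(1) by (simp_all add: feasible_route_def restrict_PiE)
    ultimately show "v \<in> (\<lambda>(x, y). V x y) ` ((H \<times> H \<rightarrow>\<^sub>E {0, 1}) \<times> (?A \<rightarrow>\<^sub>E {0, 1}))"
      unfolding xy(2) by (intro image_eqI[of _ _ "(restrict x (H \<times> H), restrict y ?A)"]) auto
  qed
  then have finS: "finite S"
    by (rule finite_subset) (intro finite_imageI finite_cartesian_product finite_PiE; simp add: finH finA)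
  have "direct_route H org dst (\<lambda>_. 0) (\<lambda>a. if a = (org, dst) then 1 else 0)"
    by (auto simp: direct_route_def)
  then have "S \<noteq> {}"
    using feasible_direct_route[OF assms] unfolding S_def by blast
  define b where "b = Min (fst ` S)"
  define T where "T = snd ` {v \<in> S. fst v = b}"
  have "b \<in> fst ` S" using finS \<open>S \<noteq> {}\<close> by (simp add: b_def)
  then have T: "finite T" "T \<noteq> {}" using finS by (auto simp: T_def)
  then have "Min T \<in> T" by simp
  then have "(b, Min T) \<in> S" by (auto simp: T_def)
  then obtain x y where xy: "feasible_route N H org dst z x y" "V x y = (b, Min T)"
    by (auto simp: S_def)
  have "lex_le (V x y) (V x' y')" if "feasible_route N H org dst z x' y'" for x' y'
  proof -
    have S': "V x' y' \<in> S" using that by (auto simp: S_def)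
    then have "b \<le> fst (V x' y')" using finS by (simp add: b_def)
    moreover have "Min T \<le> snd (V x' y')" if "fst (V x' y') = b"
      using T(1) S' that by (auto simp: T_def)
    ultimately show ?thesis unfolding xy(2) lex_le_def by fastforce
  qed
  then show ?thesis
    using xy(1) unfolding optimal_route_def V_def by blast
qed

end

theory Submission
  imports Defs
begin

text \<open>
  The cost of a route is \<open>\<theta>\<close> times its time plus \<open>(1 - \<theta>) * g\<close> times its shuttle distance.
  The direct route stays feasible when bus legs are added, so the new optimal cost is at most the
  direct cost, and the time can exceed that of the direct route only as far as shuttle distance is
  saved. By flow conservation at the origin and at the destination, a route without the direct arc
  uses shuttle legs \<open>(org, h)\<close> and \<open>(l, dst)\<close>, so it saves at most
  \<open>d org dst - (d org h + d l dst)\<close>; the bus part of the flow plays no role.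
\<close>

definition shuttle_distance ::
    "'n set \<Rightarrow> ('n \<Rightarrow> 'n \<Rightarrow> real) \<Rightarrow> 'n \<Rightarrow> 'n \<Rightarrow> 'n arc_fun \<Rightarrow> real" where
  "shuttle_distance H d org dst y = (\<Sum>(i, j)\<in>shuttle_arcs H org dst. d i j * y (i, j))"

lemma finite_shuttle_arcs: "finite H \<Longrightarrow> finite (shuttle_arcs H org dst)"
  by (simp add: shuttle_arcs_def)

text \<open>Bus legs are charged for time only, so distance enters through the shuttle legs
  alone.\<close>

lemma route_cost_eq:
  "route_cost H t d \<theta> g s org dst x y =
     \<theta> * route_time H t s org dst x y + (1 - \<theta>) * g * shuttle_distance H d org dst y"
proof -
  have "(\<Sum>(i, j)\<in>shuttle_arcs H org dst. shuttle_cost t d \<theta> g i j * y (i, j)) =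
      \<theta> * (\<Sum>(i, j)\<in>shuttle_arcs H org dst. t i j * y (i, j)) +
      (1 - \<theta>) * g * shuttle_distance H d org dst y"
    unfolding shuttle_distance_def sum_distrib_left sum.distrib[symmetric]
    by (intro sum.cong) (auto simp: shuttle_cost_def algebra_simps)
  moreover have "(\<Sum>(h, l)\<in>H \<times> H. bus_cost t \<theta> s h l * x (h, l)) =
      \<theta> * (\<Sum>(h, l)\<in>H \<times> H. (t h l + s) * x (h, l))"
    unfolding sum_distrib_left by (intro sum.cong) (auto simp: bus_cost_def)
  ultimately show ?thesis
    by (simp add: route_cost_def route_time_def algebra_simps)
qed

lemma shuttle_distance_direct:
  assumes "finite H" and "direct_route H org dst x y"
  shows "shuttle_distance H d org dst y = d org dst"
proof -
  have "shuttle_distance H d org dst y =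
      (\<Sum>a\<in>shuttle_arcs H org dst. if a = (org, dst) then d org dst else 0)"
    unfolding shuttle_distance_def
    using assms(2) by (intro sum.cong) (auto simp: direct_route_def split: if_splits)
  also have "\<dots> = d org dst"
    using finite_shuttle_arcs[OF assms(1)] by (simp add: shuttle_arcs_def)
  finally show ?thesis .
qed

text \<open>Arcs of \<open>S\<close> have weight 1, and the remaining arcs contribute nonnegative
  terms that may be dropped. This turns knowledge of a few used arcs into a lower bound.\<close>

lemma shuttle_distance_ge:
  assumes "finite H" and "\<And>i j. (i, j) \<in> shuttle_arcs H org dst \<Longrightarrow> 0 \<le> d i j"
    and "y \<in> shuttle_arcs H org dst \<rightarrow> {0, 1}"
    and "S \<subseteq> shuttle_arcs H org dst" and "\<And>a. a \<in> S \<Longrightarrow> y a = 1"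
  shows "(\<Sum>(i, j)\<in>S. d i j) \<le> shuttle_distance H d org dst y"
proof -
  have "(\<Sum>(i, j)\<in>S. d i j) = (\<Sum>(i, j)\<in>S. d i j * y (i, j))"
    using assms(5) by (intro sum.cong) auto
  also have "\<dots> \<le> shuttle_distance H d org dst y"
    unfolding shuttle_distance_def
  proof (rule sum_mono2)
    show "0 \<le> (case a of (i, j) \<Rightarrow> d i j * y (i, j))"
      if "a \<in> shuttle_arcs H org dst - S" for a
    proof (cases a)
      case (Pair i j)
      then have "(i, j) \<in> shuttle_arcs H org dst" using that by simp
      then show ?thesis using assms(2,3) Pair by (fastforce simp: Pi_def)
    qed
  qed (use assms finite_shuttle_arcs in auto)
  finally show ?thesis .
qed

text \<open>Meant for \<open>org\<close> and \<open>dst\<close>: no bus leg touches a node outside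
  \<open>H\<close>, so the balance there is carried by shuttle legs.\<close>

lemma net_outflow_outside:
  assumes "A \<subseteq> H \<times> H" and "i \<notin> H"
  shows "net_outflow A v i = 0"
proof -
  have "{a \<in> A. fst a = i} = {}" "{a \<in> A. snd a = i} = {}"
    using assms by auto
  then show ?thesis by (simp only: net_outflow_def sum.empty)
qed

text \<open>The inflow is nonnegative, so the outflow cannot vanish; some outgoing arc then has a
  nonzero value, which is 1 for a binary \<open>v\<close>.\<close>

lemma net_outflow_pos_arc:
  assumes "v \<in> A \<rightarrow> {0, 1}" and "0 < net_outflow A v i"
  obtains a where "a \<in> A" "fst a = i" "v a = 1"
proof -
  have "0 \<le> (\<Sum>a\<in>{a \<in> A. snd a = i}. v a)"
    using assms(1) by (intro sum_nonneg) (auto dest!: funcset_mem)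
  then have "(\<Sum>a\<in>{a \<in> A. fst a = i}. v a) \<noteq> 0"
    using assms(2) by (simp add: net_outflow_def)
  then obtain a where "a \<in> A" "fst a = i" "v a \<noteq> 0"
    by (metis (mono_tags, lifting) mem_Collect_eq sum.neutral)
  then show ?thesis using that assms(1) by fastforce
qed

lemma net_outflow_neg_arc:
  assumes "v \<in> A \<rightarrow> {0, 1}" and "net_outflow A v i < 0"
  obtains a where "a \<in> A" "snd a = i" "v a = 1"
proof -
  have "0 \<le> (\<Sum>a\<in>{a \<in> A. fst a = i}. v a)"
    using assms(1) by (intro sum_nonneg) (auto dest!: funcset_mem)
  then have "(\<Sum>a\<in>{a \<in> A. snd a = i}. v a) \<noteq> 0"
    using assms(2) by (simp add: net_outflow_def)
  then obtain a where "a \<in> A" "snd a = i" "v a \<noteq> 0"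
    by (metis (mono_tags, lifting) mem_Collect_eq sum.neutral)
  then show ?thesis using that assms(1) by fastforce
qed

text \<open>The shuttle flow alone has net outflow 1 at \<open>org\<close> and -1 at
  \<open>dst\<close>, which yields a used arc out of \<open>org\<close> and one into
  \<open>dst\<close>. Since neither node is a hub, such arcs are the direct one, excluded here, or
  have a hub at the other end.\<close>

lemma feasible_route_shuttle_legs:
  assumes "org \<in> N - H" and "dst \<in> N - H" and "org \<noteq> dst"
    and "feasible_route N H org dst z x y" and "y (org, dst) \<noteq> 1"
  obtains h l where "h \<in> H" "l \<in> H" "y (org, h) = 1" "y (l, dst) = 1"
proof -
  let ?A = "shuttle_arcs H org dst"
  have flow: "net_outflow (H \<times> H) x i + net_outflow ?A y i =
      (if i = org then 1 else if i = dst then -1 else 0)" if "i \<in> N" for i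
    using assms(4) that by (simp add: feasible_route_def)
  have "0 < net_outflow ?A y org" "net_outflow ?A y dst < 0"
    using flow[of org] flow[of dst] net_outflow_outside[of "H \<times> H" H _ x] assms(1-3) by auto
  moreover have "y \<in> ?A \<rightarrow> {0, 1}"
    using assms(4) by (simp add: feasible_route_def)
  ultimately obtain a b where "a \<in> ?A" "fst a = org" "y a = 1" "b \<in> ?A" "snd b = dst" "y b = 1"
    by (metis net_outflow_pos_arc net_outflow_neg_arc)
  then show ?thesis
    using that assms(1-3,5) by (auto simp: shuttle_arcs_def)
qed

text \<open>The alternatives follow whether the direct arc is used. The second is proved only with
  hubs \<open>h\<close> and \<open>l\<close> at hand, so the unspecified \<open>Min\<close> of an
  empty set does no harm.\<close>

lemma shuttle_distance_feasible_ge: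
  assumes "finite H" and "org \<in> N - H" and "dst \<in> N - H" and "org \<noteq> dst"
    and nonneg: "\<And>i j. (i, j) \<in> shuttle_arcs H org dst \<Longrightarrow> 0 \<le> d i j"
    and feas: "feasible_route N H org dst z x y"
  shows "d org dst \<le> shuttle_distance H d org dst y \<or>
    Min {d org h + d l dst | h l. h \<in> H \<and> l \<in> H} \<le> shuttle_distance H d org dst y"
proof -
  have y: "y \<in> shuttle_arcs H org dst \<rightarrow> {0, 1}"
    using feas by (simp add: feasible_route_def)
  note ge = shuttle_distance_ge[where d = d, OF assms(1) nonneg y]
  show ?thesis
  proof (cases "y (org, dst) = 1")
    case True
    then show ?thesis using ge[of "{(org, dst)}"] by (simp add: shuttle_arcs_def)
  next
    case False
    then obtain h l where hl: "h \<in> H" "l \<in> H" "y (org, h) = 1" "y (l, dst) = 1"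
      using feasible_route_shuttle_legs[OF assms(2-4) feas] by blast
    \<comment> \<open>Distinctness makes the sum over the two-element set count both legs.\<close>
    have "(org, h) \<noteq> (l, dst)" using hl assms(2) by auto
    then have le: "d org h + d l dst \<le> shuttle_distance H d org dst y"
      using ge[of "{(org, h), (l, dst)}"] hl by (auto simp: shuttle_arcs_def)
    have "{d org h + d l dst | h l. h \<in> H \<and> l \<in> H} =
        (\<lambda>(h, l). d org h + d l dst) ` (H \<times> H)"
      by auto
    then have "finite {d org h + d l dst | h l. h \<in> H \<and> l \<in> H}"
      using assms(1) by simp
    then have "Min {d org h + d l dst | h l. h \<in> H \<and> l \<in> H} \<le> d org h + d l dst"
      using hl by (intro Min_le) auto
    then show ?thesis using le by simp
  qed
qed

theorem proposition4:
  fixes N H :: "'n set" and org dst :: 'n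
    and t d :: "'n \<Rightarrow> 'n \<Rightarrow> real" and \<theta> g s t1 t2 :: real
    and z1 z2 x1 y1 x2 y2 :: "'n \<times> 'n \<Rightarrow> real"
  assumes "finite N" and "H \<subseteq> N"
    and "org \<in> N - H" and "dst \<in> N - H" and "org \<noteq> dst"
    and "\<And>i j. i \<in> N \<Longrightarrow> j \<in> N \<Longrightarrow> 0 \<le> t i j"
    and "\<And>i j. i \<in> N \<Longrightarrow> j \<in> N \<Longrightarrow> 0 \<le> d i j"
    and "\<And>i j k. i \<in> N \<Longrightarrow> j \<in> N \<Longrightarrow> k \<in> N \<Longrightarrow> t i k \<le> t i j + t j k"
    and "\<And>i j k. i \<in> N \<Longrightarrow> j \<in> N \<Longrightarrow> k \<in> N \<Longrightarrow> d i k \<le> d i j + d j k"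
    and "0 < \<theta>" and "\<theta> \<le> 1" and "0 \<le> g" and "0 \<le> s"
    and "is_design H z1" and "is_design H z2" and "design_le H z1 z2"
    and "optimal_route N H t d \<theta> g s org dst z1 x1 y1"
    and "direct_route H org dst x1 y1"
    and "t1 = route_time H t s org dst x1 y1"
    and "optimal_route N H t d \<theta> g s org dst z2 x2 y2"
    and "t2 = route_time H t s org dst x2 y2"
  shows "t2 \<le> max t1 (t1 + (1 - \<theta>) / \<theta> * g *
           (d org dst - Min {d org h + d l dst | h l. h \<in> H \<and> l \<in> H}))"
proof -
  let ?M = "Min {d org h + d l dst | h l. h \<in> H \<and> l \<in> H}"
  let ?D = "shuttle_distance H d org dst y2"
  \<comment> \<open>The exchange rate: extra time that one unit of saved shuttle distance can pay
    for at equal cost.\<close>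
  define c where "c = (1 - \<theta>) / \<theta> * g"
  have c: "0 \<le> c" using assms(10-12) by (simp add: c_def)
  have finH: "finite H" using assms(1,2) finite_subset by blast
  have feas2: "feasible_route N H org dst z2 x2 y2"
    using assms(20) by (simp add: optimal_route_def)
  have "feasible_route N H org dst z2 x1 y1"
    using feasible_direct_route[OF assms(1-5,15,18)] .
  \<comment> \<open>Lexicographic optimality bounds the first component, the cost.\<close>
  then have "route_cost H t d \<theta> g s org dst x2 y2 \<le> route_cost H t d \<theta> g s org dst x1 y1"
    using assms(20) unfolding optimal_route_def lex_le_def by fastforce
  then have "\<theta> * t2 + (1 - \<theta>) * g * ?D \<le> \<theta> * t1 + (1 - \<theta>) * g * d org dst"
    by (simp add: route_cost_eq shuttle_distance_direct[OF finH assms(18)] assms(19,21))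
  moreover have "\<theta> * c = (1 - \<theta>) * g"
    using assms(10) by (simp add: c_def)
  ultimately have "\<theta> * t2 \<le> \<theta> * (t1 + c * (d org dst - ?D))"
    by (simp add: distrib_left right_diff_distrib flip: mult.assoc)
  then have t2: "t2 \<le> t1 + c * (d org dst - ?D)"
    using assms(10) by simp
  have "0 \<le> d i j" if "(i, j) \<in> shuttle_arcs H org dst" for i j
    using that assms(2-4,7) by (auto simp: shuttle_arcs_def)
  \<comment> \<open>The alternatives match the arguments of \<open>max\<close>: either no distance
    is saved and \<open>t2\<close> is at most \<open>t1\<close>, or the saving is at most
    \<open>d org dst - ?M\<close>.\<close>
  from shuttle_distance_feasible_ge[where d = d, OF finH assms(3-5) this feas2]
  have "t2 \<le> max t1 (t1 + c * (d org dst - ?M))"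
  proof
    assume "d org dst \<le> ?D"
    then have "c * (d org dst - ?D) \<le> 0"
      using c by (simp add: mult_nonneg_nonpos)
    then show ?thesis using t2 by simp
  next
    assume "?M \<le> ?D"
    then have "c * (d org dst - ?D) \<le> c * (d org dst - ?M)"
      using c by (intro mult_left_mono) auto
    then show ?thesis using t2 by simp
  qed
  then show ?thesis by (simp add: c_def)
qed

end
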